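(* Let $(\mathcal{B},\mu)$ be a strictly positive atomless normalized measure algebra. For every $n\ge2$ and $x_1,\ldots,x_n\in[0,1]$, every bracketing of $x_1\star\cdots\star x_n$ equals the set of attainable values $$\left\{\mu\left(\bigwedge_{i=1}^n a_i\right): a_i\in\mathcal{B},\ \mu(a_i)=x_i\ (1\le i\le n)\right\}=\left[\left(\sum_{i=1}^n x_i-(n-1)\right)^+,\ \min_{1\le i\le n}x_i\right].$$
   Context: A strictly positive atomless normalized measure algebra $(\mathcal{B},\mu)$ is a Dedekind $\sigma$-complete Boolean algebra $\mathcal{B}$ with a countably additive $\mu:\mathcal{B}\to[0,1]$ such that $\mu(1)=1$, $\mu(a)>0$ for every $a\neq 0$, and $\mathcal{B}$ has no atoms. For $x,y\in[0,1]$, $x\star y:=\{\mu(a\wedge b): a,b\in\mathcal{B},\ \mu(a)=x,\ \mu(b)=y\}\subseteq[0,1]$. The operation is extended to nonempty subsets of $[0,1]$ by $A\star B:=\bigcup_{a\in A,\,b\in B}(a\star b)$, with an element $z$ identified with $\{z\}$. Here $t^+=\max\{t,0\}$. *)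

theory Defs
  imports "HOL-Analysis.Analysis" "HOL-Library.Countable_Complete_Lattices"
begin

definition atom :: "'a::boolean_algebra \<Rightarrow> bool" where
  "atom a \<longleftrightarrow> a \<noteq> bot \<and> (\<forall>b\<le>a. b = bot \<or> b = a)"

text \<open>A Dedekind sigma-complete Boolean algebra is a Boolean algebra that is also a countably
  complete lattice, i.e. every countable subset has a supremum and an infimum.
  Applied to the constant sequence \<open>bot\<close>, \<open>countably_additive\<close> gives \<open>\<mu> bot = 0\<close>.\<close>

locale strictly_positive_atomless_normalized_measure_algebra =
  fixes \<mu> :: "'a::{boolean_algebra, countable_complete_lattice} \<Rightarrow> real"
  assumes range: "\<mu> a \<in> {0..1}"
    and countably_additive:
      "(\<And>m n. m \<noteq> n \<Longrightarrow> inf (A m) (A n) = bot) \<Longrightarrow>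
        (\<lambda>n. \<mu> (A n)) sums \<mu> (SUP n. A n)"
    and normalized: "\<mu> top = 1"
    and strictly_positive: "a \<noteq> bot \<Longrightarrow> \<mu> a > 0"
    and atomless: "\<not> atom a"

definition star :: "('a::boolean_algebra \<Rightarrow> real) \<Rightarrow> real \<Rightarrow> real \<Rightarrow> real set" where
  "star \<mu> x y = {\<mu> (inf a b) | a b. \<mu> a = x \<and> \<mu> b = y}"

definition set_star :: "('a::boolean_algebra \<Rightarrow> real) \<Rightarrow> real set \<Rightarrow> real set \<Rightarrow> real set" where
  "set_star \<mu> A B = (\<Union>a\<in>A. \<Union>b\<in>B. star \<mu> a b)"

text \<open>A bracketing of \<open>x\<^sub>1 \<star> \<dots> \<star> x\<^sub>n\<close> is a binary tree whose leaves, read from left to right,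
  are \<open>x\<^sub>1, \<dots>, x\<^sub>n\<close>. A leaf \<open>x\<close> is evaluated as the singleton \<open>{x}\<close>.\<close>

datatype 'b bracketing = Operand 'b | Star "'b bracketing" "'b bracketing"

primrec operands :: "'b bracketing \<Rightarrow> 'b list" where
  "operands (Operand x) = [x]"
| "operands (Star s t) = operands s @ operands t"

primrec bracketing_value :: "('a::boolean_algebra \<Rightarrow> real) \<Rightarrow> real bracketing \<Rightarrow> real set" where
  "bracketing_value \<mu> (Operand x) = {x}"
| "bracketing_value \<mu> (Star s t) = set_star \<mu> (bracketing_value \<mu> s) (bracketing_value \<mu> t)"

end

theory Submission
  imports Defs
begin

text \<open>By Sierpinski's theorem, an atomless measure takes every intermediate value below any element.
  Hence an element \<open>c\<close> can be written as \<open>inf a b\<close> with \<open>\<mu> a = x\<close>, \<open>\<mu> b = y\<close> as soon as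
  \<open>\<mu> c \<le> x\<close>, \<open>\<mu> c \<le> y\<close> and \<open>x + y - 1 \<le> \<mu> c\<close>: enlarge \<open>c\<close> by disjoint pieces of measures
  \<open>x - \<mu> c\<close> and \<open>y - \<mu> c\<close>. So \<open>x \<star> y\<close> is an interval, and intervals are stable under \<open>\<star>\<close>.
  Because the element \<open>c\<close> itself, and not only its measure, is prescribed, the decomposition
  can be iterated to finitely many factors.\<close>

context strictly_positive_atomless_normalized_measure_algebra
begin

section \<open>Elementary calculus of the measure\<close>

lemma measure_nonneg: "0 \<le> \<mu> a" and measure_le_1: "\<mu> a \<le> 1"
  using range[of a] by auto

text \<open>A constant series converges only if its term is zero.\<close>

lemma measure_bot: "\<mu> bot = 0"
proof -
  have "(\<lambda>n::nat. \<mu> bot) sums \<mu> (SUP n::nat. bot)"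
    by (rule countably_additive) simp
  then show ?thesis
    using summable_const_iff sums_summable by blast
qed

lemma measure_sup_disjoint:
  assumes "inf a b = bot"
  shows "\<mu> (sup a b) = \<mu> a + \<mu> b"
proof -
  define A where "A n = (if n = 0 then a else if n = 1 then b else bot)" for n :: nat
  have "(\<lambda>n. \<mu> (A n)) sums \<mu> (SUP n. A n)"
    by (rule countably_additive) (use assms in \<open>auto simp: A_def inf_commute\<close>)
  moreover have "(SUP n. A n) = sup a b"
  proof (rule antisym)
    show "(SUP n. A n) \<le> sup a b"
      by (rule ccSUP_least) (auto simp: A_def)
    have "A 0 \<le> (SUP n. A n)" "A 1 \<le> (SUP n. A n)"
      by (auto intro: ccSUP_upper)
    then show "sup a b \<le> (SUP n. A n)"
      by (simp add: A_def)
  qed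
  moreover have "(\<lambda>n. \<mu> (A n)) sums (\<Sum>n\<in>{0, 1}. \<mu> (A n))"
    by (rule sums_finite) (auto simp: A_def measure_bot)
  ultimately have "\<mu> (sup a b) = (\<Sum>n\<in>{0, 1}. \<mu> (A n))"
    using sums_unique2 by metis
  then show ?thesis
    by (simp add: A_def)
qed

lemma measure_diff:
  assumes "a \<le> b"
  shows "\<mu> (inf b (- a)) = \<mu> b - \<mu> a"
proof -
  have "\<mu> (sup a (inf b (- a))) = \<mu> a + \<mu> (inf b (- a))"
    by (rule measure_sup_disjoint) (simp add: inf_left_commute)
  moreover have "sup a (inf b (- a)) = b"
    using assms by (simp add: sup_inf_distrib1 sup_absorb2)
  ultimately show ?thesis
    by simp
qed

lemma measure_mono: "a \<le> b \<Longrightarrow> \<mu> a \<le> \<mu> b"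
  using measure_diff[of a b] measure_nonneg[of "inf b (- a)"] by simp

lemma measure_compl: "\<mu> (- a) = 1 - \<mu> a"
  using measure_diff[of a top] by (simp add: normalized)

text \<open>Strict positivity applied to \<open>- a\<close>. This settles the empty meet in
  \<open>INF_decomposition\<close>.\<close>

lemma measure_eq_1_iff: "\<mu> a = 1 \<longleftrightarrow> a = top"
  using strictly_positive[of "- a"] measure_compl[of a] normalized
  by (metis compl_bot_eq double_compl diff_self less_irrefl)

lemma measure_modular: "\<mu> (sup a b) + \<mu> (inf a b) = \<mu> a + \<mu> b"
proof -
  have "sup a (inf b (- inf a b)) = sup a b"
    by (simp add: inf_sup_distrib1 sup_inf_distrib1)
  moreover have "inf a (inf b (- inf a b)) = bot"
    by (metis inf.assoc inf_compl_bot)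
  ultimately have "\<mu> (sup a b) = \<mu> a + \<mu> (inf b (- inf a b))"
    using measure_sup_disjoint by metis
  then show ?thesis
    using measure_diff[of "inf a b" b] by simp
qed

lemma measure_inf_lower: "\<mu> a + \<mu> b - 1 \<le> \<mu> (inf a b)"
  using measure_modular[of a b] measure_le_1[of "sup a b"] by linarith

text \<open>Successive differences of \<open>C\<close> are disjoint, have the same supremum as
  \<open>C\<close>, and their measures telescope to \<open>\<mu> (C n)\<close>.\<close>

lemma measure_incseq_tendsto:
  assumes "incseq C"
  shows "(\<lambda>n. \<mu> (C n)) \<longlonglongrightarrow> \<mu> (SUP n. C n)"
proof -
  define A where "A n = (case n of 0 \<Rightarrow> C 0 | Suc m \<Rightarrow> inf (C (Suc m)) (- C m))" for n
  have A_le: "A n \<le> C n" for n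
    by (cases n) (auto simp: A_def)
  have disj: "inf (A m) (A n) = bot" if "m < n" for m n
  proof -
    obtain k where k: "n = Suc k"
      using \<open>m < n\<close> by (cases n) auto
    have "A m \<le> C k"
      using A_le[of m] assms that k by (meson incseqD less_Suc_eq_le order_trans)
    moreover have "A n \<le> - C k"
      by (simp add: A_def k)
    ultimately have "inf (A m) (A n) \<le> inf (C k) (- C k)"
      by (rule inf_mono)
    then show ?thesis
      by (simp add: bot_unique)
  qed
  have "(\<lambda>n. \<mu> (A n)) sums \<mu> (SUP n. A n)"
    by (rule countably_additive) (metis disj inf_commute linorder_neqE_nat)
  moreover have "(SUP n. A n) = (SUP n. C n)"
  proof (rule antisym)
    show "(SUP n. A n) \<le> (SUP n. C n)"
      by (rule ccSUP_mono) (use A_le in auto)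
    have "C n \<le> (SUP n. A n)" for n
    proof (induction n)
      case 0
      have "A 0 \<le> (SUP n. A n)"
        by (auto intro: ccSUP_upper)
      then show ?case
        by (simp add: A_def)
    next
      case (Suc n)
      have "A (Suc n) \<le> (SUP n. A n)"
        by (auto intro: ccSUP_upper)
      moreover have "C (Suc n) \<le> sup (C n) (A (Suc n))"
        by (simp add: A_def sup_inf_distrib1)
      ultimately show ?case
        using Suc by (meson le_sup_iff order_trans sup_least)
    qed
    then show "(SUP n. C n) \<le> (SUP n. A n)"
      by (intro ccSUP_least) auto
  qed
  moreover have "(\<Sum>k\<le>n. \<mu> (A k)) = \<mu> (C n)" for n
  proof (induction n)
    case (Suc n)
    have "C n \<le> C (Suc n)"
      using assms by (simp add: incseqD)
    then show ?case
      using Suc by (simp add: A_def measure_diff)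
  qed (simp add: A_def)
  ultimately show ?thesis
    by (simp add: sums_def_le)
qed

section \<open>Intermediate values of an atomless measure\<close>

text \<open>A non-atom splits into two nonzero pieces, and the lighter one has at most half the
  measure.\<close>

lemma exists_nonzero_half:
  assumes "a \<noteq> bot"
  shows "\<exists>b\<le>a. b \<noteq> bot \<and> \<mu> b \<le> \<mu> a / 2"
proof -
  obtain b where b: "b \<le> a" "b \<noteq> bot" "b \<noteq> a"
    using atomless[of a] assms by (auto simp: atom_def)
  let ?c = "inf a (- b)"
  have c: "\<mu> ?c = \<mu> a - \<mu> b"
    using b by (simp add: measure_diff)
  have "?c \<noteq> bot"
    using b by (metis antisym double_compl inf_shunt)
  show ?thesis
  proof (cases "\<mu> b \<le> \<mu> a / 2")
    case False
    then have "\<mu> ?c \<le> \<mu> a / 2"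
      using c by simp
    then show ?thesis
      using \<open>?c \<noteq> bot\<close> inf_le1 by blast
  qed (use b in blast)
qed

lemma exists_nonzero_small:
  assumes "a \<noteq> bot" and "0 < e"
  shows "\<exists>b\<le>a. b \<noteq> bot \<and> \<mu> b < e"
proof -
  have "\<exists>b\<le>a. b \<noteq> bot \<and> \<mu> b \<le> (1 / 2) ^ k" for k
  proof (induction k)
    case 0
    then show ?case
      using assms measure_le_1[of a] by auto
  next
    case (Suc k)
    then obtain b where b: "b \<le> a" "b \<noteq> bot" "\<mu> b \<le> (1 / 2) ^ k"
      by blast
    then obtain c where c: "c \<le> b" "c \<noteq> bot" "\<mu> c \<le> \<mu> b / 2"
      using exists_nonzero_half by blast
    then have "\<mu> c \<le> (1 / 2) ^ Suc k"
      using b by simp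
    then show ?case
      using b c order_trans by blast
  qed
  moreover obtain k where "(1 / 2) ^ k < e"
    using real_arch_pow_inv[of e "1 / 2"] assms by auto
  ultimately show ?thesis
    by (meson le_less_trans)
qed

text \<open>Greedy exhaustion: each step gains at least half of what is still available below \<open>r\<close>, so a
  nonzero piece that still fits below the limit contradicts convergence.\<close>

lemma exists_measure_eq:
  assumes "0 \<le> r" "r \<le> \<mu> a"
  shows "\<exists>b\<le>a. \<mu> b = r"
proof -
  \<comment> \<open>\<open>D c\<close> collects the enlargements of \<open>c\<close> that are still
    admissible, and \<open>s c\<close> is the supremum of their measures.\<close>
  define D where "D c = {d. c \<le> d \<and> d \<le> a \<and> \<mu> d \<le> r}" for c
  define s where "s c = (SUP d\<in>D c. \<mu> d)" for c
  have le_s: "\<mu> d \<le> s c" if "d \<in> D c" for c d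
    unfolding s_def using that
    by (intro cSUP_upper bdd_aboveI[of _ r]) (auto simp: D_def)
  have step: "\<exists>d. (d \<le> a \<and> \<mu> d \<le> r) \<and> c \<le> d \<and> \<mu> d \<ge> (\<mu> c + s c) / 2"
    if "c \<le> a \<and> \<mu> c \<le> r" for c n
  \<comment> \<open>If there is room, the midpoint lies below the supremum and some candidate
    exceeds it; otherwise \<open>c\<close> itself will do.\<close>
  proof (cases "\<mu> c < s c")
    case True
    have "c \<in> D c"
      using that by (simp add: D_def)
    then obtain d where "d \<in> D c" "(\<mu> c + s c) / 2 < \<mu> d"
      using less_cSUP_iff[of "D c" \<mu> "(\<mu> c + s c) / 2"] True
      unfolding s_def[symmetric]
      by (auto simp: bdd_above_def D_def intro!: exI[of _ r])
    then show ?thesis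
      by (auto simp: D_def intro: less_imp_le)
  next
    case False
    then show ?thesis
      using that by (intro exI[of _ c]) auto
  qed
  have start: "\<exists>c. c \<le> a \<and> \<mu> c \<le> r"
    using assms measure_bot by (metis bot_least)
  obtain C where C: "C n \<le> a" "\<mu> (C n) \<le> r" "C n \<le> C (Suc n)"
      "\<mu> (C (Suc n)) \<ge> (\<mu> (C n) + s (C n)) / 2" for n :: nat
    using dependent_nat_choice[of "\<lambda>_ c. c \<le> a \<and> \<mu> c \<le> r"
        "\<lambda>_ c d. c \<le> d \<and> \<mu> d \<ge> (\<mu> c + s c) / 2", OF start step]
    by metis
  define c where "c = (SUP n. C n)"
  have lim: "(\<lambda>n. \<mu> (C n)) \<longlonglongrightarrow> \<mu> c"
    unfolding c_def by (rule measure_incseq_tendsto) (simp add: incseq_SucI C)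
  have "c \<le> a"
    unfolding c_def by (rule ccSUP_least) (use C in auto)
  have "\<mu> c \<le> r"
    using lim C(2) by (meson LIMSEQ_le_const2)
  moreover have "\<not> \<mu> c < r"
  proof
    assume less: "\<mu> c < r"
    have "\<mu> (inf a (- c)) > 0"
      using \<open>c \<le> a\<close> less assms by (simp add: measure_diff)
    then have "inf a (- c) \<noteq> bot"
      using measure_bot by auto
    \<comment> \<open>The piece \<open>e\<close> is so small that \<open>sup c e\<close> stays below
      \<open>r\<close>, hence is a candidate at every stage.\<close>
    then obtain e where e: "e \<le> inf a (- c)" "e \<noteq> bot" "\<mu> e < r - \<mu> c"
      using exists_nonzero_small[of "inf a (- c)" "r - \<mu> c"] less by auto
    have "inf c e = bot"
      using e(1) by (metis inf.bounded_iff inf_commute inf_shunt)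
    then have ce: "\<mu> (sup c e) = \<mu> c + \<mu> e"
      by (rule measure_sup_disjoint)
    have "C n \<le> c" for n
      unfolding c_def by (auto intro: ccSUP_upper)
    then have "sup c e \<in> D (C n)" for n
      using ce e \<open>c \<le> a\<close> by (auto simp: D_def le_supI1)
    then have "\<mu> c + \<mu> e \<le> s (C n)" for n
      using le_s ce by metis
    then have "\<mu> (C (Suc n)) \<ge> (\<mu> (C n) + (\<mu> c + \<mu> e)) / 2" for n
      using C(4)[of n] by (smt (verit) divide_right_mono)
    moreover have "(\<lambda>n. (\<mu> (C n) + (\<mu> c + \<mu> e)) / 2) \<longlonglongrightarrow> (\<mu> c + (\<mu> c + \<mu> e)) / 2"
      by (intro tendsto_intros lim) simp
    \<comment> \<open>Passing to the limit in the greedy inequality forces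
      \<open>\<mu> e \<le> 0\<close>.\<close>
    ultimately have "(\<mu> c + (\<mu> c + \<mu> e)) / 2 \<le> \<mu> c"
      using LIMSEQ_Suc[OF lim] by (meson LIMSEQ_le)
    then show False
      using strictly_positive[OF e(2)] by simp
  qed
  ultimately show ?thesis
    using \<open>c \<le> a\<close> by force
qed

section \<open>The binary operation on points and intervals\<close>

lemma inf_decomposition:
  assumes "\<mu> c \<le> x" "\<mu> c \<le> y" "x \<le> 1" "x + y - 1 \<le> \<mu> c"
  shows "\<exists>a b. \<mu> a = x \<and> \<mu> b = y \<and> inf a b = c"
proof -
  obtain d where d: "d \<le> - c" "\<mu> d = x - \<mu> c"
    using exists_measure_eq[of "x - \<mu> c" "- c"] assms by (auto simp: measure_compl)
  have cd: "inf c d = bot"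
    using d(1) by (metis inf_commute inf_shunt)
  then have x: "\<mu> (sup c d) = x"
    using d by (simp add: measure_sup_disjoint)
  \<comment> \<open>There is room for \<open>e\<close>: the complement has measure
    \<open>1 - x\<close>, and \<open>y - \<mu> c \<le> 1 - x\<close> is the last assumption.\<close>
  obtain e where e: "e \<le> - sup c d" "\<mu> e = y - \<mu> c"
    using exists_measure_eq[of "y - \<mu> c" "- sup c d"] x assms
    by (auto simp: measure_compl simp del: compl_sup)
  have cde: "inf (sup c d) e = bot"
    using e(1) by (metis inf_commute inf_shunt)
  then have "inf c e = bot" "inf d e = bot"
    by (auto simp: inf_sup_distrib2 sup_eq_bot_iff)
  then have "\<mu> (sup c e) = y" "inf (sup c d) (sup c e) = c"
    using e by (simp_all add: measure_sup_disjoint flip: sup_inf_distrib1)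
  then show ?thesis
    using x by blast
qed

lemma star_eq:
  assumes "x \<in> {0..1}" "y \<in> {0..1}"
  shows "star \<mu> x y = {max (x + y - 1) 0..min x y}"
proof (intro equalityI subsetI)
  fix z assume "z \<in> star \<mu> x y"
  then show "z \<in> {max (x + y - 1) 0..min x y}"
    using measure_inf_lower measure_nonneg by (auto simp: star_def intro!: measure_mono)
next
  fix z assume z: "z \<in> {max (x + y - 1) 0..min x y}"
  then obtain c where "\<mu> c = z"
    using exists_measure_eq[of z top] assms by (auto simp: normalized)
  then show "z \<in> star \<mu> x y"
    using inf_decomposition[of c x y] z assms by (auto simp: star_def)
qed

lemma set_star_interval:
  assumes "0 \<le> l" "l \<le> u" "u \<le> 1" "0 \<le> l'" "l' \<le> u'" "u' \<le> 1"
  shows "set_star \<mu> {l..u} {l'..u'} = {max (l + l' - 1) 0..min u u'}"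
proof (intro equalityI subsetI)
  fix z assume "z \<in> set_star \<mu> {l..u} {l'..u'}"
  then obtain x y where "x \<in> {l..u}" "y \<in> {l'..u'}" "z \<in> star \<mu> x y"
    by (auto simp: set_star_def)
  then show "z \<in> {max (l + l' - 1) 0..min u u'}"
    using assms star_eq[of x y] by auto
next
  fix z assume z: "z \<in> {max (l + l' - 1) 0..min u u'}"
  \<comment> \<open>These are the least points of the two intervals that are at least
    \<open>z\<close>; being least, they make the constraint \<open>x + y - 1 \<le> z\<close> easiest
    to meet.\<close>
  then have "z \<in> star \<mu> (max l z) (max l' z)"
    using assms by (subst star_eq) auto
  moreover have "max l z \<in> {l..u}" "max l' z \<in> {l'..u'}"
    using z assms by auto
  ultimately show "z \<in> set_star \<mu> {l..u} {l'..u'}"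
    unfolding set_star_def by blast
qed

section \<open>Evaluation of bracketings\<close>

lemma operands_nonempty: "operands t \<noteq> []"
  by (induction t) auto

lemma sum_list_le_length:
  fixes xs :: "real list"
  shows "set xs \<subseteq> {0..1} \<Longrightarrow> sum_list xs \<le> length xs"
  by (induction xs) auto

text \<open>The second conjunct says that the interval is nonempty; the induction carries it along
  because \<open>set_star_interval\<close> requires it.\<close>

lemma bracketing_value_eq:
  assumes "set (operands t) \<subseteq> {0..1}"
  defines "l \<equiv> \<lambda>xs::real list. max (sum_list xs - (real (length xs) - 1)) 0"
  shows "bracketing_value \<mu> t = {l (operands t)..Min (set (operands t))}
    \<and> l (operands t) \<le> Min (set (operands t))"
  using assms(1)
proof (induction t)
  case (Operand x)
  then show ?case
    by (auto simp: l_def)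
next
  case (Star s t)
  let ?xs = "operands s" and ?ys = "operands t"
  have Min: "Min (set (?xs @ ?ys)) = min (Min (set ?xs)) (Min (set ?ys))"
    by (simp add: Min_Un operands_nonempty)
  have Min1: "Min (set ?xs) \<le> 1" "Min (set ?ys) \<le> 1"
    using Star.prems Min_in[of "set ?xs"] Min_in[of "set ?ys"]
    by (auto simp: operands_nonempty subset_iff)
  have "sum_list ?xs \<le> length ?xs" "sum_list ?ys \<le> length ?ys"
    using Star.prems by (auto intro: sum_list_le_length)
  \<comment> \<open>Truncating at 0 before combining changes nothing: both values of
    \<open>l\<close> are at most 1, so if one is truncated, both sides are 0.\<close>
  then have l: "l (?xs @ ?ys) = max (l ?xs + l ?ys - 1) 0"
    unfolding l_def by (auto simp: max_def)
  have IH: "bracketing_value \<mu> s = {l ?xs..Min (set ?xs)}" "l ?xs \<le> Min (set ?xs)"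
      "bracketing_value \<mu> t = {l ?ys..Min (set ?ys)}" "l ?ys \<le> Min (set ?ys)"
    using Star by auto
  have nonneg: "0 \<le> l ?xs" "0 \<le> l ?ys"
    by (auto simp: l_def)
  have "bracketing_value \<mu> (Star s t) =
      {max (l ?xs + l ?ys - 1) 0..min (Min (set ?xs)) (Min (set ?ys))}"
    unfolding bracketing_value.simps IH(1,3)
    by (rule set_star_interval) (use IH Min1 nonneg in auto)
  moreover have "max (l ?xs + l ?ys - 1) 0 \<le> min (Min (set ?xs)) (Min (set ?ys))"
    using IH(2,4) Min1 nonneg by (auto simp: min_def max_def)
  ultimately show ?case
    unfolding operands.simps l Min by blast
qed

section \<open>Attainable measures of finite meets\<close>

lemma measure_INF_lower:
  assumes "finite I"
  shows "(\<Sum>i\<in>I. \<mu> (a i)) - (real (card I) - 1) \<le> \<mu> (INF i\<in>I. a i)"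
  using assms
proof (induction I)
  case empty
  then show ?case
    by (simp add: normalized)
next
  case (insert j I)
  have "(INF i\<in>insert j I. a i) = inf (a j) (INF i\<in>I. a i)"
    using insert by (intro ccINF_insert) (auto simp: countable_finite)
  then show ?case
    using insert measure_inf_lower[of "a j" "INF i\<in>I. a i"] by simp
qed

text \<open>Induction on \<open>I\<close> with \<open>c\<close> arbitrary: \<open>c\<close> is first
  split into a factor \<open>q\<close> for the new index and a meet \<open>p\<close> of the others,
  then the hypothesis is applied to \<open>p\<close>.\<close>

lemma INF_decomposition:
  assumes "finite I" "\<And>i. i \<in> I \<Longrightarrow> x i \<in> {0..1}" "\<And>i. i \<in> I \<Longrightarrow> \<mu> c \<le> x i"
    "(\<Sum>i\<in>I. x i) - (real (card I) - 1) \<le> \<mu> c"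
  shows "\<exists>a. (\<forall>i\<in>I. \<mu> (a i) = x i) \<and> (INF i\<in>I. a i) = c"
  using assms
proof (induction I arbitrary: c)
  \<comment> \<open>With no factors the last assumption reads \<open>1 \<le> \<mu> c\<close>, so
    \<open>c\<close> is \<open>top\<close>, the empty meet.\<close>
  case empty
  then show ?case
    using measure_le_1[of c] measure_eq_1_iff[of c] by simp
next
  case (insert j I)
  \<comment> \<open>\<open>w\<close> is the measure intended for \<open>p\<close>: the least value
    that respects both the lower bound for \<open>I\<close> and
    \<open>\<mu> c \<le> \<mu> p\<close>.\<close>
  define w where "w = max ((\<Sum>i\<in>I. x i) - (real (card I) - 1)) (\<mu> c)"
  have "(\<Sum>i\<in>I. x i) \<le> (\<Sum>i\<in>I. 1)"
    by (rule sum_mono) (use insert.prems in auto)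
  then have w1: "w \<le> 1"
    using measure_le_1[of c] by (simp add: w_def)
  have "w + x j - 1 \<le> \<mu> c" "\<mu> c \<le> w" "\<mu> c \<le> x j"
    using insert by (auto simp: w_def max_def)
  then obtain p q where pq: "\<mu> p = w" "\<mu> q = x j" "inf p q = c"
    using inf_decomposition[of c w "x j"] w1 by blast
  \<comment> \<open>All factors other than \<open>x i\<close> are at most 1, so the lower bound for
    \<open>I\<close> cannot exceed \<open>x i\<close>. The induction hypothesis for \<open>p\<close>
    needs this.\<close>
  have "w \<le> x i" if "i \<in> I" for i
  proof -
    have "(\<Sum>k\<in>I. x k) = x i + (\<Sum>k\<in>I - {i}. x k)"
      using insert.hyps that by (simp add: sum.remove)
    also have "(\<Sum>k\<in>I - {i}. x k) \<le> (\<Sum>k\<in>I - {i}. 1)"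
      by (rule sum_mono) (use insert.prems in auto)
    also have "\<dots> = real (card I) - 1"
      using insert.hyps that card_gt_0_iff[of I] by (auto simp: of_nat_diff Suc_le_eq)
    finally show ?thesis
      using insert.prems that by (simp add: w_def)
  qed
  then obtain a where a: "\<forall>i\<in>I. \<mu> (a i) = x i" "(INF i\<in>I. a i) = p"
    using insert.IH[of p] insert.prems pq by (auto simp: w_def)
  let ?a = "a(j := q)"
  have "(INF i\<in>I. ?a i) = p"
    using a insert.hyps by (metis (mono_tags, lifting) INF_cong fun_upd_other)
  moreover have "(INF i\<in>insert j I. ?a i) = inf (?a j) (INF i\<in>I. ?a i)"
    using insert.hyps by (intro ccINF_insert) (auto simp: countable_finite)
  ultimately have "(INF i\<in>insert j I. ?a i) = c"
    using pq by (simp add: inf_commute)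
  then show ?case
    using a pq insert.hyps by (intro exI[of _ ?a]) auto
qed

text \<open>Monotonicity and \<open>measure_INF_lower\<close> give the bounds. Conversely, any
  element \<open>c\<close> of measure \<open>z\<close> decomposes into factors of the required
  measures.\<close>

lemma attainable_eq:
  assumes "finite I" "I \<noteq> {}" "\<And>i. i \<in> I \<Longrightarrow> x i \<in> {0..1}"
  shows "{\<mu> (INF i\<in>I. a i) | a. \<forall>i\<in>I. \<mu> (a i) = x i} =
    {max ((\<Sum>i\<in>I. x i) - (real (card I) - 1)) 0..(MIN i\<in>I. x i)}"
proof (intro equalityI subsetI)
  fix z assume "z \<in> {\<mu> (INF i\<in>I. a i) | a. \<forall>i\<in>I. \<mu> (a i) = x i}"
  then obtain a where z: "z = \<mu> (INF i\<in>I. a i)" and a: "\<And>i. i \<in> I \<Longrightarrow> \<mu> (a i) = x i"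
    by blast
  have "z \<le> x i" if "i \<in> I" for i
    using measure_mono[OF ccINF_lower[of I i a]] that assms a z by (simp add: countable_finite)
  moreover have "(\<Sum>i\<in>I. x i) - (real (card I) - 1) \<le> z"
    using measure_INF_lower[of I a] assms(1) a z by simp
  ultimately show "z \<in> {max ((\<Sum>i\<in>I. x i) - (real (card I) - 1)) 0..(MIN i\<in>I. x i)}"
    using assms z measure_nonneg by auto
next
  fix z assume z: "z \<in> {max ((\<Sum>i\<in>I. x i) - (real (card I) - 1)) 0..(MIN i\<in>I. x i)}"
  then have z_le: "z \<le> x i" if "i \<in> I" for i
    using assms that by auto
  then have "z \<le> 1"
    using assms by (metis all_not_in_conv atLeastAtMost_iff order_trans)
  then obtain c where c: "\<mu> c = z"
    using exists_measure_eq[of z top] z by (auto simp: normalized)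
  then obtain a where "\<forall>i\<in>I. \<mu> (a i) = x i" "(INF i\<in>I. a i) = c"
    using INF_decomposition[of I x c] assms z z_le by auto
  then show "z \<in> {\<mu> (INF i\<in>I. a i) | a. \<forall>i\<in>I. \<mu> (a i) = x i}"
    using c by blast
qed

end

theorem corollary3:
  fixes \<mu> :: "'a::{boolean_algebra, countable_complete_lattice} \<Rightarrow> real"
    and n :: nat and x :: "nat \<Rightarrow> real"
  assumes "strictly_positive_atomless_normalized_measure_algebra \<mu>"
    and "n \<ge> 2"
    and "\<And>i. i \<in> {1..n} \<Longrightarrow> x i \<in> {0..1}"
  shows "(\<forall>t. operands t = map x [1..<Suc n] \<longrightarrow>
            bracketing_value \<mu> t =
              {\<mu> (INF i\<in>{1..n}. a i) | a. \<forall>i\<in>{1..n}. \<mu> (a i) = x i})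
       \<and> {\<mu> (INF i\<in>{1..n}. a i) | a. \<forall>i\<in>{1..n}. \<mu> (a i) = x i} =
            {max ((\<Sum>i=1..n. x i) - (real n - 1)) 0 .. (MIN i\<in>{1..n}. x i)}"
proof -
  interpret strictly_positive_atomless_normalized_measure_algebra \<mu>
    by fact
  have attainable: "{\<mu> (INF i\<in>{1..n}. a i) | a. \<forall>i\<in>{1..n}. \<mu> (a i) = x i} =
      {max ((\<Sum>i=1..n. x i) - (real n - 1)) 0 .. (MIN i\<in>{1..n}. x i)}"
    using attainable_eq[of "{1..n}" x] assms(2,3) by simp
  \<comment> \<open>Bracketings are not compared with the attainable set directly; both are
    identified with the same interval.\<close>
  have "bracketing_value \<mu> t =
      {max ((\<Sum>i=1..n. x i) - (real n - 1)) 0 .. (MIN i\<in>{1..n}. x i)}"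
    if t: "operands t = map x [1..<Suc n]" for t
  proof -
    have set: "set (operands t) = x ` {1..n}"
      unfolding t by (simp only: set_map set_upt atLeastLessThanSuc_atLeastAtMost)
    have sum: "sum_list (operands t) = (\<Sum>i=1..n. x i)"
      unfolding t
      by (simp only: interv_sum_list_conv_sum_set_nat set_upt atLeastLessThanSuc_atLeastAtMost)
    have length: "length (operands t) = n"
      unfolding t by simp
    have "set (operands t) \<subseteq> {0..1}"
      using assms(3) unfolding set by blast
    then show ?thesis
      using bracketing_value_eq[of t] unfolding set sum length by blast
  qed
  then show ?thesis
    unfolding attainable by blast
qed

end
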